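(* Let $m \neq \ell$. Given sets $S\subseteq[n-1]$ and $T\subseteq[n-1]$, and fixed $0\leq m, \ell\leq n-2$, the number of prime parking functions $\pi\in\mathrm{PPF}_n$ with $\mathrm{Set}_{m}(\pi)=S$ and $\mathrm{Set}_{\ell}(\pi)=T$ is $$|\{\pi \in \mathrm{PPF}_n : \mathrm{Set}_{m}(\pi)=S, \mathrm{Set}_{\ell}(\pi)=T\}| =(n-3)^{n-1-|S|-|T|}.$$
   Context: A parking function of length $n$ is a sequence of positive integers whose increasing rearrangement $\lambda$ satisfies $\lambda_i\le i$; it is prime if removing any instance of 1 yields a parking function of length $n-1$. $\mathrm{PPF}_n$ denotes the set of prime parking functions of length $n$. A tuple $(x_1,\dots,x_n)$ has an $\ell$-forward difference at $i\in[n-1]$ if $x_{i+1}-x_i\equiv\ell\pmod{n-1}$; $\mathrm{Set}_\ell(\pi)$ is the set of indices $i$ at which $\pi$ has an $\ell$-forward difference.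
   Formalization: The sets S and T are additionally assumed disjoint; for overlapping S and T the count is 0 while the formula is not (e.g. n=4, m=0, ℓ=1, S=T={1} gives 0 against 1). *)

theory Defs
  imports Main "HOL-Number_Theory.Cong"
begin

definition parking_function :: "nat \<Rightarrow> nat list \<Rightarrow> bool" where
  "parking_function n xs \<longleftrightarrow>
     length xs = n \<and> (\<forall>x\<in>set xs. 1 \<le> x) \<and> (\<forall>i\<in>{1..n}. sort xs ! (i - 1) \<le> i)"

definition remove_entry :: "nat \<Rightarrow> 'a list \<Rightarrow> 'a list" where
  "remove_entry j xs = take j xs @ drop (Suc j) xs"

definition prime_parking_function :: "nat \<Rightarrow> nat list \<Rightarrow> bool" where
  "prime_parking_function n xs \<longleftrightarrow>
     parking_function n xs \<and>
     (\<forall>j<n. xs ! j = 1 \<longrightarrow> parking_function (n - 1) (remove_entry j xs))"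

definition PPF :: "nat \<Rightarrow> nat list set" where
  "PPF n = {xs. prime_parking_function n xs}"

text \<open>Positions are numbered from 1, so the \<open>i\<close>-th entry of \<open>xs\<close> is \<open>xs ! (i - 1)\<close>;
  the modulus is \<open>length xs - 1\<close>.\<close>

definition forward_difference_at :: "int \<Rightarrow> nat list \<Rightarrow> nat \<Rightarrow> bool" where
  "forward_difference_at l xs i \<longleftrightarrow>
     [int (xs ! i) - int (xs ! (i - 1)) = l] (mod (int (length xs) - 1))"

definition forward_difference_set :: "int \<Rightarrow> nat list \<Rightarrow> nat set" where
  "forward_difference_set l xs = {i \<in> {1..length xs - 1}. forward_difference_at l xs i}"

end

theory Submission
  imports Defs "HOL-Library.FuncSet"
begin

text \<open>Put \<open>N = n - 1\<close>. A list of length \<open>n\<close> with positive entries is a prime parking function iff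
  for every \<open>1 \<le> k \<le> N\<close> more than \<open>k\<close> entries are at most \<open>k\<close>. By the cycle lemma, every list of
  length \<open>N + 1\<close> over \<open>\<int>/N\<close> has exactly one translate by a constant that is a prime parking
  function. Hence a prime parking function is determined by its \<open>N\<close> consecutive differences
  modulo \<open>N\<close>, and these may be prescribed arbitrarily. Prescribing the positions of the differences
  \<open>m\<close> and \<open>l\<close> leaves \<open>N - 2\<close> choices at each remaining position.\<close>

section \<open>Counting criteria for parking functions and prime parking functions\<close>

lemma sorted_nth_le_iff:
  fixes ys :: "'a :: linorder list"
  assumes "sorted ys" "i < length ys"
  shows "ys ! i \<le> k \<longleftrightarrow> i < length (filter (\<lambda>x. x \<le> k) ys)"
  using assms
proof (induction ys arbitrary: i)
  case (Cons y ys)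
  show ?case
  proof (cases "y \<le> k")
    case True
    with Cons show ?thesis by (cases i) auto
  next
    case False
    with Cons.prems have "\<forall>x\<in>set (y # ys). \<not> x \<le> k" by auto
    moreover from this have "filter (\<lambda>x. x \<le> k) (y # ys) = []"
      by (simp add: filter_empty_conv)
    ultimately show ?thesis using Cons.prems(2) nth_mem by (metis less_nat_zero_code list.size(3))
  qed
qed simp

lemma length_filter_sort: "length (filter P (sort xs)) = length (filter P xs)"
  by (metis mset_filter mset_sort size_mset)

lemma parking_function_iff_count:
  "parking_function n xs \<longleftrightarrow>
     length xs = n \<and> (\<forall>x\<in>set xs. 1 \<le> x) \<and> (\<forall>k\<in>{1..n}. k \<le> length (filter (\<lambda>x. x \<le> k) xs))"
proof -
  have "sort xs ! (k - 1) \<le> k \<longleftrightarrow> k \<le> length (filter (\<lambda>x. x \<le> k) xs)"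
    if "k \<in> {1..length xs}" for k
  proof -
    have "k - 1 < length xs" using that by auto
    then have "sort xs ! (k - 1) \<le> k \<longleftrightarrow> k - 1 < length (filter (\<lambda>x. x \<le> k) xs)"
      using sorted_nth_le_iff[of "sort xs" "k - 1" k] by (simp add: length_filter_sort)
    also have "\<dots> \<longleftrightarrow> k \<le> length (filter (\<lambda>x. x \<le> k) xs)" using that by auto
    finally show ?thesis .
  qed
  then show ?thesis unfolding parking_function_def by blast
qed

lemma length_filter_remove_entry:
  assumes "j < length xs" "P (xs ! j)"
  shows "length (filter P xs) = Suc (length (filter P (remove_entry j xs)))"
proof -
  have "xs = take j xs @ xs ! j # drop (Suc j) xs" using assms(1) by (rule id_take_nth_drop)
  then have "length (filter P xs) = length (filter P (take j xs @ xs ! j # drop (Suc j) xs))"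
    by simp
  then show ?thesis using assms(2) by (simp add: remove_entry_def)
qed

text \<open>Deleting an entry 1 lowers each count of entries at most k, for k \<ge> 1, by exactly
  one. The weak inequalities for the shortened list are therefore strict ones for
  \<open>xs\<close>.\<close>

lemma prime_parking_function_iff_count:
  assumes "n \<ge> 2"
  shows "prime_parking_function n xs \<longleftrightarrow>
     length xs = n \<and> (\<forall>x\<in>set xs. 1 \<le> x) \<and> (\<forall>k\<in>{1..n - 1}. k < length (filter (\<lambda>x. x \<le> k) xs))"
    (is "_ \<longleftrightarrow> ?R")
proof
  assume L: "prime_parking_function n xs"
  then have pf: "parking_function n xs" unfolding prime_parking_function_def by simp
  \<comment> \<open>Primality speaks only about entries equal to 1, so such an entry has to be
    produced first; the count at k = 1 supplies it.\<close>
  then have "1 \<le> length (filter (\<lambda>x. x \<le> 1) xs)"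
    using assms unfolding parking_function_iff_count by auto
  then have "filter (\<lambda>x. x \<le> 1) xs \<noteq> []" by (metis list.size(3) not_one_le_zero)
  then obtain x where "x \<in> set xs" "x \<le> 1" by (auto simp: filter_empty_conv)
  with pf have "1 \<in> set xs" unfolding parking_function_def by (metis le_antisym)
  then obtain j where j: "j < length xs" "xs ! j = 1" by (auto simp: in_set_conv_nth)
  with L pf have pf': "parking_function (n - 1) (remove_entry j xs)"
    unfolding prime_parking_function_def parking_function_def by auto
  have "k < length (filter (\<lambda>x. x \<le> k) xs)" if k: "k \<in> {1..n - 1}" for k
  proof -
    have "k \<le> length (filter (\<lambda>x. x \<le> k) (remove_entry j xs))"
      using pf' k unfolding parking_function_iff_count by blast
    then show ?thesis
      using length_filter_remove_entry[of j xs "\<lambda>x. x \<le> k"] j k by simp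
  qed
  with pf show ?R unfolding parking_function_iff_count by auto
next
  assume R: ?R
  have "k \<le> length (filter (\<lambda>x. x \<le> k) xs)" if k: "k \<in> {1..n}" for k
  proof (cases "k = n")
    \<comment> \<open>The criterion stops at n - 1; the bound at n follows from the strict bound
      there, since the count is monotone in k.\<close>
    case True
    have "n - 1 < length (filter (\<lambda>x. x \<le> n - 1) xs)" using R assms by auto
    also have "\<dots> \<le> length (filter (\<lambda>x. x \<le> k) xs)"
      unfolding length_filter_conv_card using True by (intro card_mono) auto
    finally show ?thesis using True by simp
  next
    case False
    then have "k \<in> {1..n - 1}" using k by auto
    then show ?thesis using R by (simp add: less_imp_le)
  qed
  then have pf: "parking_function n xs" using R unfolding parking_function_iff_count by blast
  have "parking_function (n - 1) (remove_entry j xs)" if j: "j < n" "xs ! j = 1" for j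
    unfolding parking_function_iff_count
  proof (intro conjI ballI)
    show "length (remove_entry j xs) = n - 1" using R j by (simp add: remove_entry_def)
    show "1 \<le> x" if "x \<in> set (remove_entry j xs)" for x
      using that R by (auto simp: remove_entry_def dest: in_set_takeD in_set_dropD)
    show "k \<le> length (filter (\<lambda>x. x \<le> k) (remove_entry j xs))" if k: "k \<in> {1..n - 1}" for k
    proof -
      have "k < length (filter (\<lambda>x. x \<le> k) xs)" using R k by blast
      then show ?thesis
        using length_filter_remove_entry[of j xs "\<lambda>x. x \<le> k"] R j k by simp
    qed
  qed
  with pf show "prime_parking_function n xs" unfolding prime_parking_function_def by blast
qed

text \<open>The strict count at k = n - 1 covers all n entries. So the entries are representatives
  of residues modulo n - 1, which lets the list be recovered from its residues.\<close>

lemma PPF_entry_bounds: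
  assumes "n \<ge> 2" "xs \<in> PPF n" "j < n"
  shows "1 \<le> xs ! j" "xs ! j \<le> n - 1"
proof -
  have R: "length xs = n" "\<forall>x\<in>set xs. 1 \<le> x"
      "n - 1 < length (filter (\<lambda>x. x \<le> n - 1) xs)"
    using assms by (auto simp: PPF_def prime_parking_function_iff_count)
  then show "1 \<le> xs ! j" using assms(3) by auto
  have "length (filter (\<lambda>x. x \<le> n - 1) xs) = length xs"
    using R length_filter_le[of "\<lambda>x. x \<le> n - 1" xs] by linarith
  then have "\<forall>x\<in>set xs. x \<le> n - 1" by (metis length_filter_less less_irrefl)
  then show "xs ! j \<le> n - 1" using R(1) assms(3) by auto
qed

section \<open>The cycle lemma for lists of residues\<close>

definition residue_shift :: "nat \<Rightarrow> (nat \<Rightarrow> int) \<Rightarrow> int \<Rightarrow> nat list" where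
  "residue_shift N p b = map (\<lambda>j. nat ((p j - b) mod int N) + 1) [0..<Suc N]"

text \<open>Up to a constant, the excess over \<open>t\<close> of the number of pairs of an index \<open>j\<close> and a number
  \<open>0 \<le> s < t\<close> congruent to \<open>p j\<close> modulo \<open>N\<close>.\<close>

definition excess :: "nat \<Rightarrow> (nat \<Rightarrow> int) \<Rightarrow> int \<Rightarrow> int" where
  "excess N p t = (\<Sum>j<Suc N. (t - 1 - p j) div int N) - t"

text \<open>Each of the N + 1 quotients grows by 1, while t grows by N.\<close>

lemma excess_add_period:
  assumes "N > 0"
  shows "excess N p (t + int N) = excess N p t + 1"
proof -
  have "(t + int N - 1 - p j) div int N = (t - 1 - p j) div int N + 1" for j
    using assms div_add_self2[of "int N" "t - 1 - p j"] by (simp add: algebra_simps)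
  then show ?thesis unfolding excess_def by (simp add: sum.distrib)
qed

text \<open>The left side counts the integers congruent to p modulo N in the window from b to b + k
  - 1. As k \<le> N there is at most one, and the first such integer from b on is b + (p - b) mod
  N.\<close>

lemma div_diff_eq_indicator:
  fixes N p b k :: int
  assumes "N > 0" "0 \<le> k" "k \<le> N"
  shows "(b + k - 1 - p) div N - (b - 1 - p) div N = (if (p - b) mod N < k then 1 else 0)"
proof -
  define q r where "q = (p - b) div N" and "r = (p - b) mod N"
  have p: "p - b = q * N + r" unfolding q_def r_def by simp
  have r: "0 \<le> r" "r < N" unfolding r_def using assms by auto
  have "b + i - 1 - p = (i - 1 - r) + (- q) * N" for i using p by (simp add: algebra_simps)
  then have "(b + i - 1 - p) div N = (i - 1 - r) div N - q" for i
    using assms(1) by (simp only: div_mult_self1)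
  note d = this[of k] this[of 0]
  have neg: "x div N = -1" if "- N \<le> x" "x < 0" for x
    using that assms(1) by (intro int_div_pos_eq[of _ _ _ "x + N"]) auto
  have "(0 - 1 - r) div N = -1" using r by (intro neg) auto
  moreover have "(k - 1 - r) div N = (if r < k then 0 else -1)"
    using r assms by (auto intro!: neg div_pos_pos_trivial)
  ultimately show ?thesis using d unfolding r_def by auto
qed

text \<open>Entry j of the shifted list is at most k exactly when the indicator above is 1 for p j;
  summing over j gives the count used in the criterion for primality.\<close>

lemma excess_diff_eq_count:
  assumes "N > 0" "k \<le> N"
  shows "excess N p (b + int k) - excess N p b =
    int (length (filter (\<lambda>x. x \<le> k) (residue_shift N p b))) - int k"
proof -
  have "length (filter (\<lambda>x. x \<le> k) (residue_shift N p b)) =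
      card {j \<in> {..<Suc N}. (p j - b) mod int N < int k}"
    unfolding length_filter_conv_card residue_shift_def
    using assms(1) by (intro arg_cong[where f = card])
      (auto simp: nth_append less_Suc_eq nat_less_iff Suc_le_eq simp del: upt_Suc)
  also have "int \<dots> = (\<Sum>j<Suc N. if (p j - b) mod int N < int k then 1 else 0)"
    by (simp add: sum.If_cases Int_def del: sum.lessThan_Suc)
  also have "\<dots> = (\<Sum>j<Suc N. (b + int k - 1 - p j) div int N - (b - 1 - p j) div int N)"
    using assms by (intro sum.cong refl div_diff_eq_indicator[symmetric]) auto
  finally show ?thesis unfolding excess_def by (simp add: sum_subtractf del: sum.lessThan_Suc)
qed

lemma residue_shift_in_PPF_iff:
  assumes "N > 0"
  shows "residue_shift N p b \<in> PPF (Suc N) \<longleftrightarrow>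
    (\<forall>t\<in>{b<..b + int N}. excess N p b < excess N p t)"
proof -
  have "residue_shift N p b \<in> PPF (Suc N) \<longleftrightarrow>
      (\<forall>k\<in>{1..N}. k < length (filter (\<lambda>x. x \<le> k) (residue_shift N p b)))"
    using assms by (auto simp: PPF_def prime_parking_function_iff_count residue_shift_def)
  also have "\<dots> \<longleftrightarrow> (\<forall>k\<in>{1..N}. excess N p b < excess N p (b + int k))"
  proof (intro ball_cong refl)
    fix k assume "k \<in> {1..N}"
    then show "k < length (filter (\<lambda>x. x \<le> k) (residue_shift N p b)) \<longleftrightarrow>
        excess N p b < excess N p (b + int k)"
      using excess_diff_eq_count[OF assms, of k p b] by auto
  qed
  also have "\<dots> \<longleftrightarrow> (\<forall>t\<in>{b<..b + int N}. excess N p b < excess N p t)"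
  proof (intro iffI ballI)
    fix t assume H: "\<forall>k\<in>{1..N}. excess N p b < excess N p (b + int k)" and t: "t \<in> {b<..b + int N}"
    then have "nat (t - b) \<in> {1..N}" by auto
    with H have "excess N p b < excess N p (b + int (nat (t - b)))" by blast
    then show "excess N p b < excess N p t" using t by simp
  qed auto
  finally show ?thesis .
qed

text \<open>Existence: the last minimum of \<open>excess\<close> over one period lies strictly below
  later points of that period, and also below points of the next one, where every value has gained
  1.\<close>

lemma ex1_residue_shift_in_PPF:
  assumes N: "N > 0"
  shows "\<exists>!b. b \<in> {0..<int N} \<and> residue_shift N p b \<in> PPF (Suc N)"
proof (rule ex_ex1I)
  let ?F = "excess N p"
  define M where "M = {t \<in> {0..<int N}. \<forall>s\<in>{0..<int N}. ?F t \<le> ?F s}"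
  have "finite M" by (rule finite_subset[of _ "{0..<int N}"]) (auto simp: M_def)
  have "arg_min_on ?F {0..<int N} \<in> M"
    unfolding M_def using N
    by (auto intro: arg_min_least simp: arg_min_if_finite(1)[of "{0..<int N}" ?F, simplified])
  then have "M \<noteq> {}" by auto
  \<comment> \<open>the last minimum in a period\<close>
  define b where "b = Max M"
  have b: "b \<in> M" unfolding b_def using \<open>finite M\<close> \<open>M \<noteq> {}\<close> by (rule Max_in)
  have last: "t \<le> b" if "t \<in> M" for t unfolding b_def using \<open>finite M\<close> that by (rule Max_ge)
  have "?F b < ?F t" if t: "t \<in> {b<..b + int N}" for t
  proof (cases "t < int N")
    case True
    then have t': "t \<in> {0..<int N}" using t b unfolding M_def by auto
    have "?F t \<noteq> ?F b"
    proof
      assume "?F t = ?F b"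
      then have "t \<in> M" using b t' unfolding M_def by auto
      then show False using last t by fastforce
    qed
    moreover have "?F b \<le> ?F t" using b t' unfolding M_def by blast
    ultimately show ?thesis by simp
  next
    case False
    then have "t - int N \<in> {0..<int N}" using t b unfolding M_def by auto
    then have "?F b \<le> ?F (t - int N)" using b unfolding M_def by blast
    then show ?thesis using excess_add_period[OF N, of p "t - int N"] by simp
  qed
  then show "\<exists>b. b \<in> {0..<int N} \<and> residue_shift N p b \<in> PPF (Suc N)"
    using b unfolding residue_shift_in_PPF_iff[OF N] M_def by blast
next
  let ?F = "excess N p"
  \<comment> \<open>If b < b' both qualified, b + N would lie in the window after b', so F b < F b'
    < F (b + N) = F b + 1, impossible for integers.\<close>
  have *: "\<not> b < b'"
    if b: "b \<in> {0..<int N}" "\<forall>t\<in>{b<..b + int N}. ?F b < ?F t"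
      and b': "b' \<in> {0..<int N}" "\<forall>t\<in>{b'<..b' + int N}. ?F b' < ?F t" for b b'
  proof
    assume "b < b'"
    then have "?F b < ?F b'" using b b' by auto
    moreover have "?F b' < ?F (b + int N)" using b b' \<open>b < b'\<close> by auto
    ultimately show False using excess_add_period[OF N, of p b] by simp
  qed
  fix b b'
  assume "b \<in> {0..<int N} \<and> residue_shift N p b \<in> PPF (Suc N)"
    and "b' \<in> {0..<int N} \<and> residue_shift N p b' \<in> PPF (Suc N)"
  then show "b = b'"
    unfolding residue_shift_in_PPF_iff[OF N] using *[of b b'] *[of b' b] by force
qed

section \<open>The bijection with difference sequences\<close>

definition difference_fun :: "nat \<Rightarrow> nat list \<Rightarrow> nat \<Rightarrow> int" where
  "difference_fun N xs = (\<lambda>i\<in>{1..N}. (int (xs ! i) - int (xs ! (i - 1))) mod int N)"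

text \<open>Lists with equal differences are translates of each other modulo N. Both are thus shifts
  of one p by offsets in the same period, and the cycle lemma allows only one such offset.\<close>

lemma inj_on_difference_fun:
  assumes N: "N > 0"
  shows "inj_on (difference_fun N) (PPF (Suc N))"
proof (rule inj_onI)
  fix xs ys
  assume xs: "xs \<in> PPF (Suc N)" and ys: "ys \<in> PPF (Suc N)"
    and eq: "difference_fun N xs = difference_fun N ys"
  \<comment> \<open>The -1 cancels the +1 in \<open>residue_shift\<close>, so that offset 0 returns
    \<open>xs\<close>.\<close>
  define p where "p j = int (xs ! j) - 1" for j
  define b where "b = (int (xs ! 0) - int (ys ! 0)) mod int N"
  have len: "length zs = Suc N" and bounds: "\<And>j. j < Suc N \<Longrightarrow> 1 \<le> zs ! j \<and> zs ! j \<le> N"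
    if "zs \<in> PPF (Suc N)" for zs
    using that N PPF_entry_bounds[of "Suc N" zs]
    by (auto simp: PPF_def prime_parking_function_iff_count)
  have shift: "(int (xs ! j) - int (ys ! j)) mod int N = b" if "j < Suc N" for j
    using that
  proof (induction j)
    case 0
    show ?case by (simp add: b_def)
  next
    case (Suc j)
    have "(int (xs ! Suc j) - int (xs ! j)) mod int N = (int (ys ! Suc j) - int (ys ! j)) mod int N"
      using fun_cong[OF eq, of "Suc j"] Suc.prems by (simp add: difference_fun_def)
    then have "((int (xs ! Suc j) - int (xs ! j)) + (int (xs ! j) - int (ys ! j))) mod int N =
        ((int (ys ! Suc j) - int (ys ! j)) + (int (xs ! j) - int (ys ! j))) mod int N"
      by (rule mod_add_cong) simp
    then have "(int (xs ! Suc j) - int (ys ! j) - (int (ys ! Suc j) - int (ys ! j))) mod int N =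
        ((int (ys ! Suc j) - int (ys ! j)) + (int (xs ! j) - int (ys ! j))
          - (int (ys ! Suc j) - int (ys ! j))) mod int N"
      by (intro mod_diff_cong) (simp_all add: algebra_simps)
    then show ?case using Suc by (simp add: algebra_simps)
  qed
  have "residue_shift N p 0 = xs"
  proof (rule nth_equalityI)
    show "length (residue_shift N p 0) = length xs" using len[OF xs] by (simp add: residue_shift_def)
    fix j assume "j < length (residue_shift N p 0)"
    then have j: "j < Suc N" by (simp add: residue_shift_def)
    then show "residue_shift N p 0 ! j = xs ! j"
      using bounds[OF xs j] by (simp add: residue_shift_def p_def nat_diff_distrib' del: upt_Suc)
  qed
  moreover have "residue_shift N p b = ys"
  proof (rule nth_equalityI)
    show "length (residue_shift N p b) = length ys" using len[OF ys] by (simp add: residue_shift_def)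
    fix j assume "j < length (residue_shift N p b)"
    then have j: "j < Suc N" by (simp add: residue_shift_def)
    have "(p j - b) mod int N = (p j - (int (xs ! j) - int (ys ! j))) mod int N"
      using shift[OF j] by (metis mod_diff_right_eq)
    also have "\<dots> = int (ys ! j) - 1" using bounds[OF ys j] by (simp add: p_def)
    finally show "residue_shift N p b ! j = ys ! j"
      using bounds[OF ys j] j by (simp add: residue_shift_def nat_diff_distrib' del: upt_Suc)
  qed
  moreover have "b \<in> {0..<int N}" "0 \<in> {0..<int N}" using N by (auto simp: b_def)
  ultimately show "xs = ys" using ex1_residue_shift_in_PPF[OF N, of p] xs ys by metis
qed

text \<open>For surjectivity, the partial sums of f have differences f, and the translation that the
  cycle lemma supplies leaves differences unchanged.\<close>

lemma difference_fun_image_PPF: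
  assumes N: "N > 0"
  shows "difference_fun N ` PPF (Suc N) = {1..N} \<rightarrow>\<^sub>E {0..<int N}"
proof (intro equalityI subsetI)
  fix f assume "f \<in> difference_fun N ` PPF (Suc N)"
  then show "f \<in> {1..N} \<rightarrow>\<^sub>E {0..<int N}" using N by (auto simp: difference_fun_def)
next
  fix f assume f: "f \<in> {1..N} \<rightarrow>\<^sub>E {0..<int N}"
  define p where "p j = (\<Sum>i=1..j. f i)" for j
  obtain b where b: "residue_shift N p b \<in> PPF (Suc N)"
    using ex1_residue_shift_in_PPF[OF N, of p] by blast
  have "difference_fun N (residue_shift N p b) = f"
  proof
    fix i
    show "difference_fun N (residue_shift N p b) i = f i"
    proof (cases "i \<in> {1..N}")
      case True
      have val: "int (residue_shift N p b ! j) = (p j - b) mod int N + 1" if "j < Suc N" for j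
        using that N by (simp add: residue_shift_def del: upt_Suc)
      have "difference_fun N (residue_shift N p b) i =
          ((p i - b) mod int N - (p (i - 1) - b) mod int N) mod int N"
        using True by (cases i) (simp_all add: difference_fun_def val)
      also have "\<dots> = (p i - p (i - 1)) mod int N" by (simp add: mod_diff_eq)
      also have "p i - p (i - 1) = f i" using True by (cases i) (auto simp: p_def)
      also have "f i mod int N = f i" using f True by (auto dest!: PiE_mem)
      finally show ?thesis .
    next
      \<comment> \<open>Outside {1..N} both sides are \<open>undefined\<close>; the restricted
        lambda in \<open>difference_fun\<close> makes it extensional.\<close>
      case False
      then show ?thesis using f by (auto simp: difference_fun_def PiE_def extensional_def)
    qed
  qed
  then show "f \<in> difference_fun N ` PPF (Suc N)" using b by blast
qed

text \<open>The bounds make l its own residue, so the congruence becomes an equality.\<close>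

lemma forward_difference_set_eq:
  assumes "length xs = Suc N" "0 \<le> l" "l < int N"
  shows "forward_difference_set l xs = {i \<in> {1..N}. difference_fun N xs i = l}"
  using assms by (auto simp: forward_difference_set_def forward_difference_at_def
    difference_fun_def cong_def)

section \<open>Counting the difference sequences with two prescribed level sets\<close>

theorem theorem6p5:
  fixes n :: nat and m l :: int and S T :: "nat set"
  assumes "m \<noteq> l"
    and "0 \<le> m" and "m \<le> int n - 2"
    and "0 \<le> l" and "l \<le> int n - 2"
    and "S \<subseteq> {1..n - 1}" and "T \<subseteq> {1..n - 1}"
    and "S \<inter> T = {}"
  shows "int (card {xs \<in> PPF n. forward_difference_set m xs = S \<and> forward_difference_set l xs = T})
           = (int n - 3) ^ (n - 1 - card S - card T)"
proof -
  define N where "N = n - 1"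
  \<comment> \<open>Two distinct residues between 0 and n - 2 force n \<ge> 3, so the natural number
    N - 2 is not truncated and equals n - 3.\<close>
  have n: "n = Suc N" and N: "N \<ge> 2" and ml: "m < int N" "l < int N"
    using assms(1-5) unfolding N_def by auto
  have S: "S \<subseteq> {1..N}" and T: "T \<subseteq> {1..N}" using assms(6,7) unfolding N_def by auto
  define A where "A = {xs \<in> PPF n. forward_difference_set m xs = S \<and> forward_difference_set l xs = T}"
  define B where "B i = (if i \<in> S then {m} else if i \<in> T then {l} else {0..<int N} - {m, l})" for i
  have sets: "forward_difference_set l' xs = {i \<in> {1..N}. difference_fun N xs i = l'}"
    if "xs \<in> PPF n" "0 \<le> l'" "l' < int N" for xs l'
    using that n by (intro forward_difference_set_eq)
      (auto simp: PPF_def prime_parking_function_def parking_function_def)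
  define Q where "Q f \<longleftrightarrow> {i \<in> {1..N}. f i = m} = S \<and> {i \<in> {1..N}. f i = l} = T" for f :: "nat \<Rightarrow> int"
  have "A = {xs \<in> PPF n. Q (difference_fun N xs)}"
    unfolding A_def Q_def using sets assms(2,4) ml by auto
  then have "difference_fun N ` A = {f \<in> difference_fun N ` PPF n. Q f}" by blast
  also have "\<dots> = {f \<in> {1..N} \<rightarrow>\<^sub>E {0..<int N}. Q f}"
    using difference_fun_image_PPF[of N] N n by simp
  \<comment> \<open>\<open>Q\<close> constrains each position separately, so it cuts out a product.
    Disjointness of S and T ensures that \<open>B\<close> takes the value {l} on all of T.\<close>
  also have "\<dots> = PiE {1..N} B"
  proof (intro equalityI subsetI)
    fix f assume "f \<in> {f \<in> {1..N} \<rightarrow>\<^sub>E {0..<int N}. Q f}"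
    then show "f \<in> PiE {1..N} B" by (auto simp: PiE_iff Q_def B_def)
  next
    fix f assume f: "f \<in> PiE {1..N} B"
    have fi: "f i \<in> {0..<int N} \<and> (f i = m \<longleftrightarrow> i \<in> S) \<and> (f i = l \<longleftrightarrow> i \<in> T)" if "i \<in> {1..N}" for i
      using PiE_mem[OF f that] assms(1,2,4,8) ml by (auto simp: B_def split: if_splits)
    then have "Q f" unfolding Q_def using S T by blast
    with f fi show "f \<in> {f \<in> {1..N} \<rightarrow>\<^sub>E {0..<int N}. Q f}" by (auto simp: PiE_iff)
  qed
  finally have img: "difference_fun N ` A = PiE {1..N} B" .
  have "inj_on (difference_fun N) A"
    using inj_on_difference_fun[of N] N n by (auto simp: A_def intro: inj_on_subset)
  then have "card A = card (PiE {1..N} B)" using card_image img by metis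
  also have "\<dots> = (\<Prod>i\<in>{1..N}. card (B i))" by (rule card_PiE) simp
  also have "\<dots> = (\<Prod>i\<in>{1..N}. if i \<in> S \<union> T then 1 else N - 2)"
  proof (intro prod.cong refl)
    have "card ({0..<int N} - {m, l}) = N - 2"
      using assms(1,2,4) ml by (subst card_Diff_subset) auto
    then show "card (B i) = (if i \<in> S \<union> T then 1 else N - 2)" for i by (auto simp: B_def)
  qed
  also have "\<dots> = (N - 2) ^ card ({1..N} - (S \<union> T))"
    by (simp add: prod.If_cases Diff_eq Compl_eq)
  also have "card ({1..N} - (S \<union> T)) = N - card S - card T"
    using S T assms(8) by (simp add: card_Diff_subset card_Un_disjoint finite_subset)
  finally show ?thesis unfolding A_def[symmetric] using n N by (simp add: of_nat_diff)
qed

end
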